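(* Let $F=\mathbb{F}_q$ be a finite field, let $m\ge 1$, and let $R=F[x]/\langle x^m-1\rangle$. Let $C\subseteq R^2$ be a quasi-cyclic code of length $2m$ and index $2$, generated by $g_1=(g_{11}(x),g_{12}(x))$ and $g_2=(0,g_{22}(x))$, where $g_{11},g_{12},g_{22}\in F[x]$ satisfy: $g_{11}(x)\mid (x^m-1)$ and $g_{22}(x)\mid (x^m-1)$; $\deg g_{12}(x)<\deg g_{22}(x)$; and $g_{11}(x)g_{22}(x)\mid (x^m-1)g_{12}(x)$. Define the following cyclic codes (ideals of $R$): $$C_1=\langle g_{11}(x)\rangle,\quad C_2=\langle g_{22}(x)\rangle,\quad C_3=\langle \gcd(g_{12}(x),g_{22}(x))\rangle,\quad C_4=\left\langle \frac{g_{11}(x)g_{22}(x)}{\gcd(g_{12}(x),g_{22}(x))}\right\rangle .$$ Then $$d(C)\ge \min\{d(C_2),\ d(C_4),\ d(C_1)+d(C_3)\}.$$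
   Context: A quasi-cyclic code of length $2m$ and index $2$ over $F$ (a linear subspace of $F^{2m}$ invariant under the square of the cyclic shift) is identified with an $R$-submodule of $R^2$: a vector $(c_{0,0},c_{0,1},c_{1,0},c_{1,1},\dots,c_{m-1,0},c_{m-1,1})$ corresponds to $(c_0(x),c_1(x))$ with $c_j(x)=\sum_{i=0}^{m-1} c_{i,j}x^i$. "Generated by" means generated as an $R$-module; polynomials are also regarded as elements of $R$ by reduction modulo $x^m-1$. Divisibility and gcd are in $F[x]$; convention $\deg 0=-\infty$, so $g_{12}=0$ is allowed (and $\gcd(0,g_{22})=g_{22}$ up to a unit). The Hamming weight of an element of $R$ is the number of nonzero coefficients of its representative of degree $<m$; the Hamming weight of $(a(x),b(x))\in R^2$ is the sum of the weights of $a(x)$ and $b(x)$. $d(\cdot)$ denotes minimum Hamming distance (the minimum weight of a nonzero codeword), with the convention $d(\{0\})=\infty$. *)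

theory Defs
  imports
    "HOL-Algebra.Algebraic_Closure_Type"
    "HOL-Algebra.Module"
    "HOL-Algebra.QuotRing"
    "HOL-Algebra.Divisibility"
    "HOL-Library.Extended_Nat"
begin

hide_const (open) UnivPoly.monom UnivPoly.coeff

abbreviation fpoly_ring :: "'a :: field poly ring" where
  "fpoly_ring \<equiv> ring_of_type_algebra"

definition cyc_poly :: "nat \<Rightarrow> 'a :: field poly" where
  "cyc_poly m = Polynomial.monom 1 m - 1"

definition cyc_ring :: "nat \<Rightarrow> 'a :: field poly set ring" where
  "cyc_ring m = fpoly_ring Quot (PIdl\<^bsub>fpoly_ring\<^esub> (cyc_poly m))"

definition residue :: "nat \<Rightarrow> 'a :: field poly \<Rightarrow> 'a poly set" where
  "residue m p = (PIdl\<^bsub>fpoly_ring\<^esub> (cyc_poly m)) +>\<^bsub>fpoly_ring\<^esub> p"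

text \<open>The representative of degree \<open>< m\<close>; for \<open>m \<ge> 1\<close> the condition also covers the zero
  polynomial, whose degree is \<open>0\<close> in the library.\<close>

definition representative :: "nat \<Rightarrow> 'a :: field poly set \<Rightarrow> 'a poly" where
  "representative m a = (THE p. p \<in> a \<and> Polynomial.degree p < m)"

definition weight :: "nat \<Rightarrow> 'a :: field poly set \<Rightarrow> nat" where
  "weight m a = card {i. Polynomial.coeff (representative m a) i \<noteq> 0}"

definition weight2 :: "nat \<Rightarrow> 'a :: field poly set \<times> 'a poly set \<Rightarrow> nat" where
  "weight2 m c = weight m (fst c) + weight m (snd c)"

text \<open>The module \<open>R\<^sup>2\<close> over \<open>R\<close>. The library's record type for modules extends that of rings,
  so the ring product has to be given as well; it plays no role.\<close>

definition square_module ::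
    "('r, 's) ring_scheme \<Rightarrow> ('r, 'r \<times> 'r) module" where
  "square_module R =
    \<lparr>carrier = carrier R \<times> carrier R,
     monoid.mult = (\<lambda>(a, b) (c, d). (a \<otimes>\<^bsub>R\<^esub> c, b \<otimes>\<^bsub>R\<^esub> d)),
     monoid.one = (\<one>\<^bsub>R\<^esub>, \<one>\<^bsub>R\<^esub>),
     ring.zero = (\<zero>\<^bsub>R\<^esub>, \<zero>\<^bsub>R\<^esub>),
     ring.add = (\<lambda>(a, b) (c, d). (a \<oplus>\<^bsub>R\<^esub> c, b \<oplus>\<^bsub>R\<^esub> d)),
     module.smult = (\<lambda>r (a, b). (r \<otimes>\<^bsub>R\<^esub> a, r \<otimes>\<^bsub>R\<^esub> b))\<rparr>"

definition generated_submodule ::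
    "('r, 's) ring_scheme \<Rightarrow> ('r, 'v, 't) module_scheme \<Rightarrow> 'v set \<Rightarrow> 'v set" where
  "generated_submodule R M S = \<Inter>{N. submodule N R M \<and> S \<subseteq> N}"

text \<open>A quasi-cyclic code of length \<open>2m\<close> and index \<open>2\<close>, in the polynomial description: the
  vector \<open>(c\<^sub>0\<^sub>0, c\<^sub>0\<^sub>1, c\<^sub>1\<^sub>0, c\<^sub>1\<^sub>1, \<dots>)\<close> is the pair of the classes of \<open>\<Sum>i<m. c\<^sub>i\<^sub>0 x\<^sup>i\<close> and
  \<open>\<Sum>i<m. c\<^sub>i\<^sub>1 x\<^sup>i\<close>, and the square of the cyclic shift is multiplication by \<open>x\<close>.\<close>

definition quasi_cyclic_code :: "nat \<Rightarrow> ('a :: field poly set \<times> 'a poly set) set \<Rightarrow> bool" where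
  "quasi_cyclic_code m C \<longleftrightarrow> submodule C (cyc_ring m) (square_module (cyc_ring m))"

text \<open>Minimum distances take values in \<^typ>\<open>enat\<close>; the infimum of the empty set is \<open>\<infinity>\<close>, which
  is the value for the zero code.\<close>

definition min_dist :: "nat \<Rightarrow> 'a :: field poly set set \<Rightarrow> enat" where
  "min_dist m C = (INF c \<in> C - {\<zero>\<^bsub>cyc_ring m\<^esub>}. enat (weight m c))"

definition min_dist2 :: "nat \<Rightarrow> ('a :: field poly set \<times> 'a poly set) set \<Rightarrow> enat" where
  "min_dist2 m C = (INF c \<in> C - {\<zero>\<^bsub>square_module (cyc_ring m)\<^esub>}. enat (weight2 m c))"

lemma cring_cyc_ring: "cring (cyc_ring m :: 'a :: field poly set ring)"
proof -
  interpret P: cring "fpoly_ring :: 'a poly ring" by (rule cring_from_type_algebra)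
  show ?thesis
    unfolding cyc_ring_def
    by (intro ideal.quotient_is_cring P.cgenideal_ideal P.cring_axioms)
       (simp add: ring_of_type_algebra_def)
qed

lemma module_square_module:
  assumes "cring R"
  shows "module R (square_module R)"
proof -
  interpret cring R by fact
  have "\<exists>y \<in> carrier R \<times> carrier R.
      (case y of (c, d) \<Rightarrow> (c \<oplus>\<^bsub>R\<^esub> a, d \<oplus>\<^bsub>R\<^esub> b)) = (\<zero>\<^bsub>R\<^esub>, \<zero>\<^bsub>R\<^esub>)"
    if "a \<in> carrier R" "b \<in> carrier R" for a b
    using that by (intro bexI[of _ "(\<ominus>\<^bsub>R\<^esub> a, \<ominus>\<^bsub>R\<^esub> b)"]) (auto simp: l_neg)
  then show ?thesis
    by (intro moduleI abelian_groupI)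
       (auto simp: square_module_def cring_axioms a_ac l_distr r_distr m_assoc)
qed

lemma residue_eq: "residue m p = {p + r * cyc_poly m | r. True}"
  by (auto simp: residue_def a_r_coset_def r_coset_def cgenideal_def ring_of_type_algebra_def
      add.commute)

lemma carrier_cyc_ring: "carrier (cyc_ring m) = range (residue m)"
  by (auto simp: cyc_ring_def FactRing_def A_RCOSETS_def RCOSETS_def residue_def a_r_coset_def
      ring_of_type_algebra_def)

lemma zero_cyc_ring: "\<zero>\<^bsub>cyc_ring m\<^esub> = residue m 0"
  by (auto simp: residue_eq cyc_ring_def FactRing_def cgenideal_def ring_of_type_algebra_def)

lemma degree_cyc_poly:
  assumes "m \<ge> 1"
  shows "Polynomial.degree (cyc_poly m :: 'a :: field poly) = m"
proof -
  have "Polynomial.degree (Polynomial.monom 1 m + (- 1) :: 'a poly) = m"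
    using assms by (subst degree_add_eq_left) (auto simp: degree_monom_eq)
  then show ?thesis by (simp add: cyc_poly_def)
qed

lemma representative_residue:
  fixes p :: "'a :: field poly"
  assumes "m \<ge> 1"
  shows "representative m (residue m p) = p mod cyc_poly m"
  unfolding representative_def
proof (rule the_equality)
  have nz: "(cyc_poly m :: 'a poly) \<noteq> 0"
    using degree_cyc_poly[OF assms, where ?'a = 'a] assms by auto
  have "p mod cyc_poly m = p + (- (p div cyc_poly m)) * cyc_poly m"
    by (simp add: minus_div_mult_eq_mod[symmetric])
  then have "p mod cyc_poly m \<in> residue m p"
    unfolding residue_eq by blast
  moreover have "Polynomial.degree (p mod cyc_poly m) < m"
    using degree_mod_less[OF nz, of p] degree_cyc_poly[OF assms, where ?'a = 'a] assms by auto
  ultimately show "p mod cyc_poly m \<in> residue m p \<and> Polynomial.degree (p mod cyc_poly m) < m" ..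
next
  fix q assume "q \<in> residue m p \<and> Polynomial.degree q < m"
  then obtain r where r: "q = p + r * cyc_poly m" "Polynomial.degree q < m"
    by (auto simp: residue_eq)
  then have "q = q mod cyc_poly m"
    using degree_cyc_poly[OF assms, where ?'a = 'a] by (metis mod_poly_less)
  also have "\<dots> = p mod cyc_poly m" by (simp add: r(1))
  finally show "q = p mod cyc_poly m" .
qed

end

theory Submission
  imports Defs
begin

text \<open>A codeword is \<open>(a g\<^sub>1\<^sub>1, a g\<^sub>1\<^sub>2 + b g\<^sub>2\<^sub>2)\<close>. If its first component vanishes, the divisibility
  assumption gives \<open>g\<^sub>2\<^sub>2 | a g\<^sub>1\<^sub>2\<close>, so the second one lies in \<open>C\<^sub>2\<close>. If its second component vanishes,
  then \<open>g\<^sub>2\<^sub>2 | a g\<^sub>1\<^sub>2\<close> as well, hence \<open>g\<^sub>2\<^sub>2 / h | a\<close> and the first one lies in \<open>C\<^sub>4\<close>. Otherwise both are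
  nonzero and lie in \<open>C\<^sub>1\<close> and \<open>C\<^sub>3\<close>.\<close>

lemma carrier_fpoly_ring: "carrier fpoly_ring = UNIV"
  by (simp add: ring_of_type_algebra_def)

lemma residue_ring_hom: "residue m \<in> ring_hom fpoly_ring (cyc_ring m)"
proof -
  interpret P: cring "fpoly_ring :: 'a :: field poly ring" by (rule cring_from_type_algebra)
  have "ideal (PIdl\<^bsub>fpoly_ring\<^esub> (cyc_poly m :: 'a poly)) fpoly_ring"
    by (rule P.cgenideal_ideal) (simp add: carrier_fpoly_ring)
  then show ?thesis
    using ideal.rcos_ring_hom unfolding cyc_ring_def residue_def[abs_def] by blast
qed

lemma residue_add: "residue m p \<oplus>\<^bsub>cyc_ring m\<^esub> residue m q = residue m (p + q)"
  using ring_hom_add[OF residue_ring_hom, of p q m] by (simp add: ring_of_type_algebra_def)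

lemma residue_mult: "residue m p \<otimes>\<^bsub>cyc_ring m\<^esub> residue m q = residue m (p * q)"
  using ring_hom_mult[OF residue_ring_hom, of p q m] by (simp add: ring_of_type_algebra_def)

text \<open>A class contains its own representative, and the zero class consists of the multiples of
  the modulus. Thus the vanishing of a component of a codeword becomes divisibility in F[x], where
  factors can be cancelled.\<close>

lemma residue_eq_zero_iff: "residue m p = \<zero>\<^bsub>cyc_ring m\<^esub> \<longleftrightarrow> cyc_poly m dvd p"
proof
  assume "residue m p = \<zero>\<^bsub>cyc_ring m\<^esub>"
  moreover have "p \<in> residue m p"
    unfolding residue_eq by (auto intro!: exI[of _ 0])
  ultimately show "cyc_poly m dvd p"
    by (auto simp: zero_cyc_ring residue_eq)
next
  assume "cyc_poly m dvd p"
  then obtain k where k: "p = cyc_poly m * k" ..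
  have "p + r * cyc_poly m = 0 + (k + r) * cyc_poly m"
    "0 + r * cyc_poly m = p + (r - k) * cyc_poly m" for r
    by (simp_all add: k algebra_simps)
  then show "residue m p = \<zero>\<^bsub>cyc_ring m\<^esub>"
    unfolding zero_cyc_ring residue_eq by blast
qed

lemma residue_in_PIdl:
  assumes "g dvd p"
  shows "residue m p \<in> PIdl\<^bsub>cyc_ring m\<^esub> (residue m g)"
proof -
  obtain k where "p = k * g" using assms by (metis dvdE mult.commute)
  then have "residue m p = residue m k \<otimes>\<^bsub>cyc_ring m\<^esub> residue m g"
    by (simp add: residue_mult)
  then show ?thesis by (auto simp: cgenideal_def carrier_cyc_ring)
qed

lemma fpoly_divides_iff: "p divides\<^bsub>fpoly_ring\<^esub> q \<longleftrightarrow> p dvd q"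
  by (auto simp: factor_def ring_of_type_algebra_def dvd_def)

text \<open>A nonzero combination of \<open>u\<close> and \<open>v\<close> of least degree divides
  every combination, since otherwise the remainder would be a nonzero combination of smaller
  degree.\<close>

lemma poly_bezout:
  fixes u v :: "'a :: field poly"
  obtains s t where "s * u + t * v dvd u" "s * u + t * v dvd v"
proof -
  define P where "P d \<longleftrightarrow> d \<noteq> 0 \<and> (\<exists>s t. d = s * u + t * v)" for d
  show thesis
  proof (cases "u = 0 \<and> v = 0")
    case True
    then show ?thesis using that[of 0 0] by simp
  next
    case False
    \<comment> \<open>Whichever of \<open>u\<close> and \<open>v\<close> is nonzero is itself a
      candidate, so a least degree exists.\<close>
    have "u = 1 * u + 0 * v" "v = 0 * u + 1 * v" by simp_all
    with False have "\<exists>d. P d" unfolding P_def by metis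
    then obtain d where d: "P d" and min: "\<And>d'. P d' \<Longrightarrow> degree d \<le> degree d'"
      using exists_least_iff[of "\<lambda>n. \<exists>d. P d \<and> degree d = n"] by (metis not_less)
    obtain s t where st: "d = s * u + t * v" and nz: "d \<noteq> 0" using d by (auto simp: P_def)
    have "d dvd x" if "x = s' * u + t' * v" for x s' t'
    proof (rule ccontr)
      assume "\<not> d dvd x"
      then have "x mod d \<noteq> 0" by (simp add: dvd_eq_mod_eq_0)
      moreover have "x mod d = (s' - x div d * s) * u + (t' - x div d * t) * v"
        by (simp add: minus_div_mult_eq_mod[symmetric]) (simp add: that st algebra_simps)
      ultimately have "P (x mod d)" unfolding P_def by blast
      from min[OF this] degree_mod_less[OF nz, of x] \<open>x mod d \<noteq> 0\<close> show False by simp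
    qed
    from this[of u 1 0] this[of v 0 1] show ?thesis using that st by simp
  qed
qed

text \<open>After cancelling \<open>h\<close>, the cofactors of \<open>p\<close> and
  \<open>q\<close> are coprime, so the cofactor of \<open>q\<close> can only divide the product
  through \<open>a\<close>.\<close>

lemma gcdof_div_dvd:
  fixes p q h a :: "'a :: field poly"
  assumes h: "h gcdof\<^bsub>fpoly_ring\<^esub> p q" and q: "q \<noteq> 0" and dvd: "q dvd a * p"
  shows "q div h dvd a"
proof -
  have hp: "h dvd p" "h dvd q" and greatest: "\<And>d. d dvd p \<Longrightarrow> d dvd q \<Longrightarrow> d dvd h"
    using h by (auto simp: isgcd_def fpoly_divides_iff carrier_fpoly_ring)
  obtain v u where v: "p = h * v" and u: "q = h * u" using hp by (auto simp: dvd_def)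
  have h0: "h \<noteq> 0" using u q by auto
  obtain s t where st: "s * u + t * v dvd u" "s * u + t * v dvd v" by (rule poly_bezout)
  \<comment> \<open>The Bezout combination is a common divisor of \<open>u\<close> and
    \<open>v\<close>, so \<open>h\<close> times it is a common divisor of \<open>p\<close> and
    \<open>q\<close> and hence divides \<open>h\<close>. Cancelling \<open>h\<close> makes the
    combination a unit.\<close>
  have "h * (s * u + t * v) dvd h * 1"
    using greatest[of "h * (s * u + t * v)"] st by (simp add: u v mult_dvd_mono)
  then have unit: "s * u + t * v dvd 1" using h0 dvd_mult_cancel_left by blast
  have "u dvd a * v" using dvd h0 by (simp add: u v mult.left_commute[of a])
  moreover have "a * (s * u + t * v) = a * s * u + t * (a * v)" by (simp add: algebra_simps)
  ultimately have "u dvd a * (s * u + t * v)" by simp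
  then have "u dvd a" using unit by (simp add: dvd_mult_unit_iff)
  then show ?thesis using h0 by (simp add: u)
qed

text \<open>The combinations of \<open>x\<close> and \<open>y\<close> form a submodule containing
  both, so the intersection of all such submodules lies inside it.\<close>

lemma (in module) generated_submodule_pair:
  assumes x: "x \<in> carrier M" and y: "y \<in> carrier M"
    and z: "z \<in> generated_submodule R M {x, y}"
  obtains r s where "r \<in> carrier R" "s \<in> carrier R" "z = r \<odot>\<^bsub>M\<^esub> x \<oplus>\<^bsub>M\<^esub> s \<odot>\<^bsub>M\<^esub> y"
proof -
  define N where "N = {r \<odot>\<^bsub>M\<^esub> x \<oplus>\<^bsub>M\<^esub> s \<odot>\<^bsub>M\<^esub> y | r s. r \<in> carrier R \<and> s \<in> carrier R}"
  have NI: "r \<odot>\<^bsub>M\<^esub> x \<oplus>\<^bsub>M\<^esub> s \<odot>\<^bsub>M\<^esub> y \<in> N" if "r \<in> carrier R" "s \<in> carrier R" for r s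
    using that by (auto simp: N_def)
  have sub: "N \<subseteq> carrier M" using x y by (auto simp: N_def)
  have smult: "a \<odot>\<^bsub>M\<^esub> n \<in> N" if a: "a \<in> carrier R" and n: "n \<in> N" for a n
  proof -
    obtain r s where rs: "r \<in> carrier R" "s \<in> carrier R"
      and n: "n = r \<odot>\<^bsub>M\<^esub> x \<oplus>\<^bsub>M\<^esub> s \<odot>\<^bsub>M\<^esub> y" using n by (auto simp: N_def)
    have "a \<odot>\<^bsub>M\<^esub> n = (a \<otimes> r) \<odot>\<^bsub>M\<^esub> x \<oplus>\<^bsub>M\<^esub> (a \<otimes> s) \<odot>\<^bsub>M\<^esub> y"
      using a rs x y by (simp add: n smult_r_distr smult_assoc1)
    then show ?thesis using NI a rs by simp
  qed
  have "submodule N R M"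
  proof (rule submoduleI)
    show "N \<subseteq> carrier M" by (rule sub)
    show "\<zero>\<^bsub>M\<^esub> \<in> N" using NI[of \<zero> \<zero>] x y by simp
    \<comment> \<open>Negation is scaling by \<open>\<ominus> \<one>\<close>.\<close>
    show "\<ominus>\<^bsub>M\<^esub> a \<in> N" if "a \<in> N" for a
      using smult[of "\<ominus> \<one>" a] that sub smult_l_minus[of \<one> a] by auto
    show "a \<oplus>\<^bsub>M\<^esub> b \<in> N" if ab: "a \<in> N" "b \<in> N" for a b
    proof -
      obtain r s r' s' where rs: "r \<in> carrier R" "s \<in> carrier R" "r' \<in> carrier R" "s' \<in> carrier R"
        and ab: "a = r \<odot>\<^bsub>M\<^esub> x \<oplus>\<^bsub>M\<^esub> s \<odot>\<^bsub>M\<^esub> y" "b = r' \<odot>\<^bsub>M\<^esub> x \<oplus>\<^bsub>M\<^esub> s' \<odot>\<^bsub>M\<^esub> y"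
        using ab by (auto simp: N_def)
      have "a \<oplus>\<^bsub>M\<^esub> b = (r \<oplus> r') \<odot>\<^bsub>M\<^esub> x \<oplus>\<^bsub>M\<^esub> (s \<oplus> s') \<odot>\<^bsub>M\<^esub> y"
        using rs x y by (simp add: ab smult_l_distr M.add.m_ac)
      then show ?thesis using NI rs by simp
    qed
  qed (rule smult)
  moreover have "x \<in> N" "y \<in> N" using NI[of \<one> \<zero>] NI[of \<zero> \<one>] x y by simp_all
  ultimately have "z \<in> N" using z by (auto simp: generated_submodule_def)
  then show thesis using that by (auto simp: N_def)
qed

text \<open>Both coefficients of a combination of the generators are classes of polynomials; lifting
  them describes a codeword by two polynomials \<open>a\<close> and \<open>b\<close>.\<close>

lemma generated_code_word:
  assumes "c \<in> generated_submodule (cyc_ring m) (square_module (cyc_ring m))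
             {(residue m g11, residue m g12), (residue m 0, residue m g22)}"
  obtains a b where "c = (residue m (a * g11), residue m (a * g12 + b * g22))"
proof -
  let ?M = "square_module (cyc_ring m) :: ('a poly set, 'a poly set \<times> 'a poly set) module"
  interpret M: module "cyc_ring m" ?M
    by (rule module_square_module[OF cring_cyc_ring])
  have "(residue m p, residue m q) \<in> carrier ?M" for p q
    by (simp add: square_module_def carrier_cyc_ring)
  from M.generated_submodule_pair[OF this this assms] obtain r s
    where "r \<in> carrier (cyc_ring m)" "s \<in> carrier (cyc_ring m)"
      and c: "c = r \<odot>\<^bsub>?M\<^esub> (residue m g11, residue m g12) \<oplus>\<^bsub>?M\<^esub> s \<odot>\<^bsub>?M\<^esub> (residue m 0, residue m g22)"
    by blast
  then obtain a b where "r = residue m a" "s = residue m b" by (auto simp: carrier_cyc_ring)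
  with c have "c = (residue m (a * g11), residue m (a * g12 + b * g22))"
    by (simp add: square_module_def residue_add residue_mult)
  then show thesis by (rule that)
qed

lemma min_dist_le_weight:
  assumes "c \<in> C" "c \<noteq> \<zero>\<^bsub>cyc_ring m\<^esub>"
  shows "min_dist m C \<le> enat (weight m c)"
  unfolding min_dist_def using assms by (intro INF_lower) auto

theorem theorem3p4:
  fixes g11 g12 g22 h :: "'a :: {field, finite} poly"
    and m :: nat
    and C :: "('a poly set \<times> 'a poly set) set"
    and C1 C2 C3 C4 :: "'a poly set set"
  assumes "m \<ge> 1"
    and "g11 dvd cyc_poly m"
    and "g22 dvd cyc_poly m"
    and "g12 = 0 \<or> Polynomial.degree g12 < Polynomial.degree g22"
    and "g11 * g22 dvd cyc_poly m * g12"
    and "h gcdof\<^bsub>fpoly_ring\<^esub> g12 g22"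
    and "quasi_cyclic_code m C"
    and "C = generated_submodule (cyc_ring m) (square_module (cyc_ring m))
               {(residue m g11, residue m g12), (residue m 0, residue m g22)}"
    and "C1 = PIdl\<^bsub>cyc_ring m\<^esub> (residue m g11)"
    and "C2 = PIdl\<^bsub>cyc_ring m\<^esub> (residue m g22)"
    and "C3 = PIdl\<^bsub>cyc_ring m\<^esub> (residue m h)"
    and "C4 = PIdl\<^bsub>cyc_ring m\<^esub> (residue m (g11 * g22 div h))"
  shows "min_dist2 m C \<ge> min (min_dist m C2) (min (min_dist m C4) (min_dist m C1 + min_dist m C3))"
  unfolding min_dist2_def
proof (rule INF_greatest)
  let ?M = "cyc_poly m :: 'a poly"
  fix c assume "c \<in> C - {\<zero>\<^bsub>square_module (cyc_ring m)\<^esub>}"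
  then have c: "c \<in> C" "c \<noteq> (\<zero>\<^bsub>cyc_ring m\<^esub>, \<zero>\<^bsub>cyc_ring m\<^esub>)" by (simp_all add: square_module_def)
  obtain a b where ab: "c = (residue m (a * g11), residue m (a * g12 + b * g22))"
    using c(1) unfolding assms(8) by (rule generated_code_word)
  define c1 c2 where "c1 = residue m (a * g11)" and "c2 = residue m (a * g12 + b * g22)"
  have w: "enat (weight2 m c) = enat (weight m c1) + enat (weight m c2)"
    by (simp add: ab c1_def c2_def weight2_def)
  \<comment> \<open>The modulus has degree \<open>m\<close>, which is positive, so its divisors
    \<open>g11\<close> and \<open>g22\<close> are nonzero and may be cancelled below.\<close>
  have M0: "?M \<noteq> 0" using degree_cyc_poly[OF assms(1), where ?'a = 'a] assms(1) by auto
  have g22: "g22 \<noteq> 0" and g11: "g11 \<noteq> 0" using assms(2,3) M0 by auto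
  have h: "h dvd g12" "h dvd g22"
    using assms(6) by (auto simp: isgcd_def fpoly_divides_iff)
  consider "c1 = \<zero>\<^bsub>cyc_ring m\<^esub>" "c2 \<noteq> \<zero>\<^bsub>cyc_ring m\<^esub>" | "c1 \<noteq> \<zero>\<^bsub>cyc_ring m\<^esub>" "c2 = \<zero>\<^bsub>cyc_ring m\<^esub>"
    | "c1 \<noteq> \<zero>\<^bsub>cyc_ring m\<^esub>" "c2 \<noteq> \<zero>\<^bsub>cyc_ring m\<^esub>"
    using c(2) by (auto simp: ab c1_def c2_def)
  then show "min (min_dist m C2) (min (min_dist m C4) (min_dist m C1 + min_dist m C3))
      \<le> enat (weight2 m c)"
  proof cases
    case 1
    \<comment> \<open>The multiples of \<open>k\<close> are exactly the polynomials whose product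
      with \<open>g11\<close> vanishes in R, and cancelling \<open>g11\<close> in the divisibility
      hypothesis gives \<open>g22 dvd k * g12\<close>.\<close>
    obtain k where k: "?M = g11 * k" using assms(2) ..
    have "k dvd a" using 1(1) g11 by (simp add: c1_def residue_eq_zero_iff k mult.commute[of a])
    moreover have "g22 dvd k * g12" using assms(5) g11 by (simp add: k mult.assoc)
    ultimately have "g22 dvd a * g12" by (meson dvd_trans dvd_refl mult_dvd_mono)
    then have "c2 \<in> C2" unfolding assms(10) c2_def by (intro residue_in_PIdl) simp
    then have "min_dist m C2 \<le> enat (weight m c2)" using 1(2) by (rule min_dist_le_weight)
    also have "\<dots> \<le> enat (weight2 m c)" by (simp add: w)
    finally show ?thesis by (simp add: min.coboundedI1)
  next
    case 2
    have "?M dvd a * g12 + b * g22" using 2(2) by (simp add: c2_def residue_eq_zero_iff)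
    \<comment> \<open>Vanishing modulo the cyclic polynomial implies vanishing modulo its divisor
      \<open>g22\<close>, which removes the term with \<open>b\<close>.\<close>
    with assms(3) have "g22 dvd a * g12 + b * g22" by (rule dvd_trans)
    then have "g22 dvd a * g12" by simp
    then have "g22 div h dvd a" by (rule gcdof_div_dvd[OF assms(6) g22])
    \<comment> \<open>The generator of \<open>C4\<close> divides the whole product by
      \<open>h\<close>; as \<open>h\<close> divides \<open>g22\<close>, the division can be moved
      onto that factor.\<close>
    moreover have "g11 * g22 div h = g22 div h * g11"
      using h(2) by (simp add: div_mult_swap mult.commute)
    ultimately have "c1 \<in> C4" unfolding assms(12) c1_def by (intro residue_in_PIdl) simp
    then have "min_dist m C4 \<le> enat (weight m c1)" using 2(1) by (rule min_dist_le_weight)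
    also have "\<dots> \<le> enat (weight2 m c)" by (simp add: w)
    finally show ?thesis by (simp add: min.coboundedI1 min.coboundedI2)
  next
    case 3
    have "c1 \<in> C1" unfolding assms(9) c1_def by (intro residue_in_PIdl) simp
    moreover have "c2 \<in> C3" unfolding assms(11) c2_def using h by (intro residue_in_PIdl) simp
    \<comment> \<open>Both components are nonzero, so each weight is bounded by the distance of its
      own cyclic code and the bounds add.\<close>
    ultimately have "min_dist m C1 + min_dist m C3 \<le> enat (weight2 m c)"
      unfolding w using 3 by (intro add_mono min_dist_le_weight)
    then show ?thesis by (simp add: min.coboundedI2)
  qed
qed

end
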